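(* Let $H$ be a sparse semigroup of genus $g\ge 4$ with Frobenius number $\ell_g=2g-4$. Then $H$ is one of the following: (1) $H=3\mathbb{N}+H_8$, and $H$ is $3$-hyperelliptic; (2) $H=3\mathbb{N}+H_{10}$, and $H$ is $4$-hyperelliptic; (3) $H=4\mathbb{N}+H_6$, and $H$ is $2$-hyperelliptic; (4) $H=H_4$, and $H$ is $2$-hyperelliptic; (5) $H=5\mathbb{N}+H_6$, and $H$ is $3$-hyperelliptic; (6) $H=\{0,5,7\}\cup H_8$, and $H$ is $4$-hyperelliptic.
   Context: $\mathbb{N}$ is the set of natural numbers including $0$. A numerical semigroup $H\subseteq\mathbb{N}$ of genus $g\ge 1$ is a subset containing $0$, closed under addition, whose complement $\mathbb{N}\setminus H=\{1=\ell_1<\ell_2<\dots<\ell_g\}$ has exactly $g$ elements, called gaps; $\ell_g$ is the Frobenius number. $H$ is sparse if $\ell_i-\ell_{i-1}\le 2$ for all $i=2,\dots,g$. A numerical semigroup is $\gamma$-hyperelliptic if it has exactly $\gamma$ even gaps. For $n\in\mathbb{N}$, $H_n:=\{0,n+1,n+2,\dots\}$; $m\mathbb{N}+H_n:=\{ma+h: a\in\mathbb{N},\,h\in H_n\}$. *)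

theory Defs
  imports Main
begin

definition numerical_semigroup :: "nat set \<Rightarrow> bool" where
  "numerical_semigroup H \<longleftrightarrow>
     0 \<in> H \<and> (\<forall>x\<in>H. \<forall>y\<in>H. x + y \<in> H) \<and> finite (- H)"

definition gaps :: "nat set \<Rightarrow> nat set" where
  "gaps H = - H"

definition genus :: "nat set \<Rightarrow> nat" where
  "genus H = card (gaps H)"

text \<open>
  The gaps of \<open>H\<close> in increasing order, indexed from 1 as in
  \<open>\<ell>\<^sub>1 < \<dots> < \<ell>\<^sub>g\<close>; only meaningful for \<open>1 \<le> i \<le> genus H\<close>.
\<close>
definition gap :: "nat set \<Rightarrow> nat \<Rightarrow> nat" where
  "gap H i = sorted_list_of_set (gaps H) ! (i - 1)"

definition frobenius_number :: "nat set \<Rightarrow> nat" where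
  "frobenius_number H = gap H (genus H)"

text \<open>
  The gaps increase with their index, so the truncated subtraction below is
  the true difference.
\<close>
definition sparse_semigroup :: "nat set \<Rightarrow> bool" where
  "sparse_semigroup H \<longleftrightarrow>
     numerical_semigroup H \<and> (\<forall>i\<in>{2..genus H}. gap H i - gap H (i - 1) \<le> 2)"

definition hyperelliptic :: "nat \<Rightarrow> nat set \<Rightarrow> bool" where
  "hyperelliptic \<gamma> H \<longleftrightarrow>
     numerical_semigroup H \<and> card {l \<in> gaps H. even l} = \<gamma>"

definition ordinary :: "nat \<Rightarrow> nat set" where
  "ordinary n = insert 0 {n + 1..}"

text \<open>\<open>m\<nat> + H\<^sub>n\<close>\<close>
definition multiples_plus_ordinary :: "nat \<Rightarrow> nat \<Rightarrow> nat set" where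
  "multiples_plus_ordinary m n = {m * a + h | a h. h \<in> ordinary n}"

end

theory Submission
  imports Defs
begin

text \<open>
  Let \<open>f = 2g - 4\<close>. Since \<open>f\<close> is a gap, each of the \<open>g - 3\<close> pairs \<open>{i, f - i}\<close> with
  \<open>1 \<le> i \<le> g - 3\<close> contains at most one element of \<open>H\<close>, and \<open>f / 2\<close> is a gap. As \<open>H\<close> has
  \<open>g - 4\<close> positive elements below \<open>f\<close>, exactly one pair consists of two gaps. Neither 1 nor 2
  lies in \<open>H\<close>, and sparsity forbids that \<open>f - 1\<close> and \<open>f - 2\<close> both do; so the exceptional pair
  is the first or the second one. Following the pairs with \<open>i = 3, 4, 5\<close> then excludes
  \<open>g \<ge> 8\<close> and determines \<open>H\<close> for smaller \<open>g\<close>.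
\<close>

section \<open>Numerical semigroups, their gaps, and the symmetry about half the Frobenius
  number\<close>

lemma numerical_semigroup_add:
  assumes "numerical_semigroup H" "x \<in> H" "y \<in> H"
  shows "x + y \<in> H"
  using assms by (auto simp: numerical_semigroup_def)

lemma numerical_semigroup_mult:
  assumes "numerical_semigroup H" "x \<in> H"
  shows "x * k \<in> H"
  using assms by (induction k) (auto simp: numerical_semigroup_def)

text \<open>The sorted list of gaps has length \<open>genus H\<close>, so the index
  \<open>genus H - 1\<close> read by \<open>frobenius_number\<close> is that of its last
  entry.\<close>

lemma frobenius_number_eq_Max:
  assumes "finite (gaps H)" "gaps H \<noteq> {}"
  shows "frobenius_number H = Max (gaps H)"
proof -
  let ?l = "sorted_list_of_set (gaps H)"
  have "?l \<noteq> []"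
    using assms by simp
  then have "frobenius_number H = last ?l"
    by (simp add: frobenius_number_def gap_def genus_def last_conv_nth)
  also have "\<dots> = Max (gaps H)"
  proof (rule Max_eqI[symmetric])
    show "last ?l \<in> gaps H"
      using last_in_set[OF \<open>?l \<noteq> []\<close>] assms(1) by simp
    fix y assume "y \<in> gaps H"
    then obtain i where "i < length ?l" "?l ! i = y"
      using assms(1) by (metis in_set_conv_nth set_sorted_list_of_set)
    then show "y \<le> last ?l"
      using \<open>?l \<noteq> []\<close> sorted_nth_mono[OF sorted_sorted_list_of_set[of "gaps H"], of i "length ?l - 1"]
      by (simp add: last_conv_nth)
  qed (use assms in simp)
  finally show ?thesis .
qed

text \<open>Otherwise the last gap below \<open>x\<close> and the first gap above
  \<open>Suc x\<close> would be neighbours in the list of gaps and differ by at least 3. The gap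
  \<open>z\<close> ensures that the upper one exists, the gap 1 the lower one.\<close>

lemma sparse_semigroup_not_consecutive:
  assumes "sparse_semigroup H" "x \<in> H" "0 < x" "Suc x < z" "z \<notin> H"
  shows "Suc x \<notin> H"
proof
  assume suc: "Suc x \<in> H"
  let ?l = "sorted_list_of_set (gaps H)"
  have S: "numerical_semigroup H" and fin: "finite (gaps H)"
    using assms(1) by (auto simp: sparse_semigroup_def numerical_semigroup_def gaps_def)
  have one: "1 \<notin> H"
    using numerical_semigroup_mult[OF S, of 1 z] assms(5) by auto
  have set: "set ?l = - H"
    using fin by (simp add: gaps_def)
  have len: "length ?l = genus H"
    by (simp add: genus_def)
  obtain k where "k < length ?l" "?l ! k = z"
    using assms(5) set by (metis ComplI in_set_conv_nth)
  then have ex: "k < length ?l \<and> Suc x < ?l ! k"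
    using assms(4) by simp
  \<comment> \<open>The 0-based list position of the first gap beyond \<open>Suc x\<close>.\<close>
  define i where "i = (LEAST i. i < length ?l \<and> Suc x < ?l ! i)"
  have i: "i < length ?l" "Suc x < ?l ! i"
    using LeastI[of "\<lambda>i. i < length ?l \<and> Suc x < ?l ! i", OF ex] by (auto simp: i_def)
  have "i \<noteq> 0"
  proof
    assume "i = 0"
    obtain j where "j < length ?l" "?l ! j = 1"
      using one set by (metis ComplI in_set_conv_nth)
    then have "?l ! i \<le> 1"
      using sorted_nth_mono[OF sorted_sorted_list_of_set[of "gaps H"], of 0 j] \<open>i = 0\<close> by simp
    then show False
      using i by simp
  qed
  have "\<not> Suc x < ?l ! (i - 1)"
    using not_less_Least[of "i - 1" "\<lambda>i. i < length ?l \<and> Suc x < ?l ! i"] \<open>i \<noteq> 0\<close> i(1)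
    by (auto simp: i_def)
  moreover have "?l ! (i - 1) \<notin> H"
    using set nth_mem[of "i - 1" ?l] i(1) by auto
  ultimately have "?l ! (i - 1) < x"
    using assms(2) suc by (metis le_SucE linorder_neqE_nat not_le order.order_iff_strict)
  \<comment> \<open>\<open>gap\<close> counts from 1, so these are the list entries at positions
    \<open>i\<close> and \<open>i - 1\<close>.\<close>
  moreover have "gap H (i + 1) - gap H i \<le> 2"
  proof -
    have "i + 1 \<in> {2..genus H}"
      using \<open>i \<noteq> 0\<close> i(1) len by simp
    then show ?thesis
      using assms(1) unfolding sparse_semigroup_def by fastforce
  qed
  ultimately show False
    using i(2) by (simp add: gap_def)
qed

text \<open>By counting: if \<open>{i, f - i}\<close> and \<open>{j, f - j}\<close> both consisted
  of gaps, the \<open>genus H - 4\<close> positive elements of \<open>H\<close> below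
  \<open>f\<close> would have to lie in only \<open>genus H - 5\<close> pairs, with at most one in
  each.\<close>

lemma symmetric_pairs:
  fixes H :: "nat set"
  assumes S: "numerical_semigroup H" and f: "f \<notin> H" "gaps H \<subseteq> {1..f}"
    and g: "f + 4 = 2 * genus H"
    and ij: "0 < i" "i < j" "2 * j < f"
  shows "i \<in> H \<or> f - i \<in> H \<or> j \<in> H \<or> f - j \<in> H"
proof (rule ccontr)
  assume neg: "\<not> ?thesis"
  define P where "P = H \<inter> {1..f}"
  \<comment> \<open>Labels each pair \<open>{x, f - x}\<close> by its smaller member;
    \<open>\<phi>\<close> is injective on \<open>P\<close> because no two elements of
    \<open>P\<close> sum to \<open>f\<close>.\<close>
  define \<phi> where "\<phi> x = min x (f - x)" for x
  have sum: "x + y \<noteq> f" if "x \<in> P" "y \<in> P" for x y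
    using numerical_semigroup_add[OF S, of x y] that f by (auto simp: P_def)
  have "P = {1..f} - gaps H"
    by (auto simp: P_def gaps_def)
  then have cardP: "card P = f - genus H"
    using f by (simp add: card_Diff_subset finite_subset genus_def)
  have "inj_on \<phi> P"
  proof (rule inj_onI)
    fix x y assume "x \<in> P" "y \<in> P" "\<phi> x = \<phi> y"
    then show "x = y"
      using sum[of x y] by (auto simp: P_def \<phi>_def min_def split: if_splits)
  qed
  moreover have "\<phi> ` P \<subseteq> {1..genus H - 3} - {i, j}"
  proof
    fix w assume "w \<in> \<phi> ` P"
    then obtain x where x: "x \<in> P" "w = \<phi> x" by auto
    have "x \<le> f" "x \<noteq> f" "0 < x" "x + x \<noteq> f"
      using x(1) f sum by (auto simp: P_def)
    have "x \<noteq> i" "x \<noteq> j" "x \<noteq> f - i" "x \<noteq> f - j"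
      using x(1) neg by (auto simp: P_def)
    show "w \<in> {1..genus H - 3} - {i, j}"
    proof (cases "2 * x < f")
      case True
      then have "w = x" "x \<le> genus H - 3"
        using x(2) g by (simp_all add: \<phi>_def)
      then show ?thesis
        using \<open>0 < x\<close> \<open>x \<noteq> i\<close> \<open>x \<noteq> j\<close> by simp
    next
      case False
      then have "w = f - x" "f - x \<le> genus H - 3" "0 < f - x"
        using x(2) g \<open>x + x \<noteq> f\<close> \<open>x \<le> f\<close> \<open>x \<noteq> f\<close> by (simp_all add: \<phi>_def)
      moreover have "f - x \<noteq> i" "f - x \<noteq> j"
        using \<open>x \<noteq> f - i\<close> \<open>x \<noteq> f - j\<close> \<open>x \<le> f\<close> by auto
      ultimately show ?thesis
        by simp
    qed
  qed
  ultimately have "card P \<le> card ({1..genus H - 3} - {i, j})"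
    by (intro card_inj_on_le) auto
  also have "\<dots> = genus H - 5"
    using ij g by (subst card_Diff_subset) auto
  finally show False
    using cardP ij g by linarith
qed

section \<open>Membership criteria for the listed semigroups, and checking them point by
  point\<close>

lemma ordinary_eq: "ordinary n = {x. x = 0 \<or> n < x}"
  by (auto simp: ordinary_def)

lemma multiples_plus_ordinary_eq:
  "multiples_plus_ordinary m n = {x. m dvd x \<or> n < x}"
proof (intro set_eqI iffI)
  fix x assume "x \<in> multiples_plus_ordinary m n"
  then show "x \<in> {x. m dvd x \<or> n < x}"
    by (auto simp: multiples_plus_ordinary_def ordinary_def)
next
  fix x assume "x \<in> {x. m dvd x \<or> n < x}"
  then have "\<exists>a h. x = m * a + h \<and> (h = 0 \<or> n < h)"
    by (metis add.right_neutral add_0 dvdE mem_Collect_eq mult_0_right)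
  then show "x \<in> multiples_plus_ordinary m n"
    by (auto simp: multiples_plus_ordinary_def ordinary_def Suc_le_eq)
qed

lemma hyperellipticI:
  assumes "numerical_semigroup H" "{l. l \<notin> H \<and> even l} = A" "card A = \<gamma>"
  shows "hyperelliptic \<gamma> H"
  using assms by (simp add: hyperelliptic_def gaps_def)

text \<open>For genus at most 7 the Frobenius number is at most 10, so comparing two of the sets
  involved takes eleven single values and one common tail.\<close>

lemma less_11_cases:
  fixes x :: nat
  obtains "x = 0" | "x = 1" | "x = 2" | "x = 3" | "x = 4" | "x = 5" | "x = 6" | "x = 7"
    | "x = 8" | "x = 9" | "x = 10" | "10 < x"
proof -
  have "x \<in> {0, 1, 2, 3, 4, 5, 6, 7, 8, 9, 10}" if "\<not> 10 < x"
    using that by (auto simp: not_less numeral_eq_Suc le_Suc_eq)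
  then show thesis
    using that by blast
qed

section \<open>Case analysis on the genus\<close>

theorem theorem2p8:
  fixes H :: "nat set" and g :: nat
  assumes "sparse_semigroup H"
    and "genus H = g"
    and "g \<ge> 4"
    and "frobenius_number H = 2 * g - 4"
  shows "(H = multiples_plus_ordinary 3 8 \<and> hyperelliptic 3 H) \<or>
         (H = multiples_plus_ordinary 3 10 \<and> hyperelliptic 4 H) \<or>
         (H = multiples_plus_ordinary 4 6 \<and> hyperelliptic 2 H) \<or>
         (H = ordinary 4 \<and> hyperelliptic 2 H) \<or>
         (H = multiples_plus_ordinary 5 6 \<and> hyperelliptic 3 H) \<or>
         (H = {0, 5, 7} \<union> ordinary 8 \<and> hyperelliptic 4 H)"
proof -
  define f where "f = 2 * g - 4"
  have S: "numerical_semigroup H" and fin: "finite (gaps H)"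
    using assms(1) by (auto simp: sparse_semigroup_def numerical_semigroup_def gaps_def)
  have ne: "gaps H \<noteq> {}"
    using assms(2,3) by (auto simp: genus_def)
  have fMax: "f = Max (gaps H)"
    using frobenius_number_eq_Max[OF fin ne] assms(4) f_def by simp
  have f: "f \<notin> H"
    using Max_in[OF fin ne] fMax by (simp add: gaps_def)
  have above: "x \<in> H" if "f < x" for x
    using Max_ge[OF fin, of x] that fMax by (auto simp: gaps_def)
  have zero: "0 \<in> H"
    using S by (simp add: numerical_semigroup_def)
  have sub: "gaps H \<subseteq> {1..f}"
  proof
    fix x assume "x \<in> gaps H"
    then show "x \<in> {1..f}"
      using above[of x] zero by (cases "x = 0") (auto simp: gaps_def not_less[symmetric])
  qed
  have pairs: "i \<in> H \<or> f - i \<in> H \<or> j \<in> H \<or> f - j \<in> H" if "0 < i" "i < j" "2 * j < f" for i j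
    using symmetric_pairs[OF S f sub _ that] assms(2,3) f_def by simp
  have cons: "x + 1 \<notin> H" if "x \<in> H" "0 < x" "x + 1 < f" for x
    using sparse_semigroup_not_consecutive[OF assms(1) that(1,2) _ f] that(3) by simp
  have mult: "x \<notin> H" if "x dvd f" for x
    using numerical_semigroup_mult[OF S, of x] f that by auto
  have add: "x + y \<in> H" if "x \<in> H" "y \<in> H" for x y
    using numerical_semigroup_add[OF S that] .
  have dvdH: "y \<in> H" if "x \<in> H" "x dvd y" for x y
    using numerical_semigroup_mult[OF S that(1)] that(2) by auto
  have diff: "f - x \<notin> H" if "x \<in> H" "x \<le> f" for x
    using add[of x "f - x"] that f by auto
  have evenf: "even f"
    by (simp add: f_def)
  have n1: "1 \<notin> H" and n2: "2 \<notin> H"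
    using mult[of 1] mult[of 2] evenf by auto
  \<comment> \<open>This locates the exceptional pair: if \<open>f - 1\<close> is in
    \<open>H\<close> it is \<open>{2, f - 2}\<close>, and \<open>pairs[of 2 j]\<close> then applies
    to every later pair; otherwise it is \<open>{1, f - 1}\<close>, and \<open>pairs[of 1 j]\<close>
    does.\<close>
  have edge: "(f - 1 \<in> H \<and> f - 2 \<notin> H) \<or> (f - 1 \<notin> H \<and> f - 2 \<in> H)" if "g \<ge> 5"
  proof -
    have "f \<ge> 6"
      using that by (simp add: f_def)
    then have "f - 1 \<in> H \<or> f - 2 \<in> H" "f - 2 + 1 = f - 1"
      using pairs[of 1 2] n1 n2 by auto
    then show ?thesis
      using cons[of "f - 2"] \<open>f \<ge> 6\<close> by fastforce
  qed
  consider "g = 4" | "g = 5" | "g = 6" | "g = 7" | "g \<ge> 8"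
    using assms(3) by linarith
  then show ?thesis
  proof cases
    case 1
    then have f4: "f = 4" by (simp add: f_def)
    \<comment> \<open>Here genus and Frobenius number are both 4, which leaves no room for an
      element of \<open>H\<close> in \<open>{1..4}\<close>.\<close>
    have "gaps H = {1..4}"
      using sub assms(2) 1 f4 by (intro card_subset_eq) (auto simp: genus_def)
    then have "- H = {1..4}"
      by (simp add: gaps_def)
    then have "x \<in> H \<longleftrightarrow> x \<notin> {1..4}" for x
      by blast
    then have H: "H = ordinary 4"
      unfolding ordinary_eq by (intro set_eqI) (simp, linarith)
    have "{l. l \<notin> H \<and> even l} = {2, 4}"
      unfolding H ordinary_eq by (rule set_eqI, rule_tac x = x in less_11_cases) simp_all
    then have "hyperelliptic 2 H"
      using S by (rule_tac hyperellipticI) auto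
    then show ?thesis using H by simp
  next
    case 2
    then have f6: "f = 6" by (simp add: f_def)
    have n3: "3 \<notin> H" and n6: "6 \<notin> H"
      using mult[of 3] f f6 by auto
    have ab: "x \<in> H" if "6 < x" for x
      using above that f6 by simp
    \<comment> \<open>Only 4 and 5, that is \<open>f - 2\<close> and \<open>f - 1\<close>, are still
      undecided.\<close>
    from edge 2 f6 consider "5 \<in> H" "4 \<notin> H" | "5 \<notin> H" "4 \<in> H" by auto
    then show ?thesis
    proof cases
      case 1
      have H: "H = multiples_plus_ordinary 5 6"
        unfolding multiples_plus_ordinary_eq
        by (rule set_eqI, rule_tac x = x in less_11_cases)
          (use 1 n1 n2 n3 n6 zero ab in simp_all)
      have "{l. l \<notin> H \<and> even l} = {2, 4, 6}"
        unfolding H multiples_plus_ordinary_eq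
        by (rule set_eqI, rule_tac x = x in less_11_cases) simp_all
      then have "hyperelliptic 3 H"
        using S by (rule_tac hyperellipticI) auto
      then show ?thesis using H by simp
    next
      case 2
      have H: "H = multiples_plus_ordinary 4 6"
        unfolding multiples_plus_ordinary_eq
        by (rule set_eqI, rule_tac x = x in less_11_cases)
          (use 2 n1 n2 n3 n6 zero ab in simp_all)
      have "{l. l \<notin> H \<and> even l} = {2, 6}"
        unfolding H multiples_plus_ordinary_eq
        by (rule set_eqI, rule_tac x = x in less_11_cases) simp_all
      then have "hyperelliptic 2 H"
        using S by (rule_tac hyperellipticI) auto
      then show ?thesis using H by simp
    qed
  next
    case 3
    then have f8: "f = 8" by (simp add: f_def)
    have n4: "4 \<notin> H" and n8: "8 \<notin> H"
      using mult[of 4] f f8 by auto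
    have ab: "x \<in> H" if "8 < x" for x
      using above that f8 by simp
    from edge 3 f8 consider "7 \<in> H" "6 \<notin> H" | "7 \<notin> H" "6 \<in> H" by auto
    then show ?thesis
    proof cases
      case 1
      have n3: "3 \<notin> H"
        using dvdH[of 3 6] 1 by auto
      then have m5: "5 \<in> H"
        using pairs[of 2 3] n2 1 f8 by simp
      have H: "H = {0, 5, 7} \<union> ordinary 8"
        unfolding ordinary_eq
        by (rule set_eqI, rule_tac x = x in less_11_cases)
          (use 1 n1 n2 n3 n4 m5 n8 zero ab in simp_all)
      have "{l. l \<notin> H \<and> even l} = {2, 4, 6, 8}"
        unfolding H ordinary_eq by (rule set_eqI, rule_tac x = x in less_11_cases) simp_all
      then have "hyperelliptic 4 H"
        using S by (rule_tac hyperellipticI) auto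
      then show ?thesis using H by simp
    next
      case 2
      have n5: "5 \<notin> H"
        using cons[of 5] 2 f8 by auto
      then have m3: "3 \<in> H"
        using pairs[of 1 3] n1 2 f8 by simp
      have H: "H = multiples_plus_ordinary 3 8"
        unfolding multiples_plus_ordinary_eq
        by (rule set_eqI, rule_tac x = x in less_11_cases)
          (use 2 n1 n2 m3 n4 n5 n8 zero ab in simp_all)
      have "{l. l \<notin> H \<and> even l} = {2, 4, 8}"
        unfolding H multiples_plus_ordinary_eq
        by (rule set_eqI, rule_tac x = x in less_11_cases) simp_all
      then have "hyperelliptic 3 H"
        using S by (rule_tac hyperellipticI) auto
      then show ?thesis using H by simp
    qed
  next
    case 4
    then have f10: "f = 10" by (simp add: f_def)
    have n5: "5 \<notin> H" and n10: "10 \<notin> H"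
      using mult[of 5] f f10 by auto
    have ab: "x \<in> H" if "10 < x" for x
      using above that f10 by simp
    \<comment> \<open>With \<open>{1, 9}\<close> exceptional, sparsity removes 7, so the pair
      \<open>{3, 7}\<close> puts 3 into \<open>H\<close>, and with it 9.\<close>
    have "\<not> (9 \<notin> H \<and> 8 \<in> H)"
    proof
      assume *: "9 \<notin> H \<and> 8 \<in> H"
      then have "7 \<notin> H"
        using cons[of 7] f10 by auto
      then have "3 \<in> H"
        using pairs[of 1 3] n1 * f10 by simp
      then show False
        using dvdH[of 3 9] * by auto
    qed
    then have m9: "9 \<in> H" and n8: "8 \<notin> H"
      using edge 4 f10 by auto
    have n4: "4 \<notin> H"
      using dvdH[of 4 8] n8 by auto
    then have m6: "6 \<in> H"
      using pairs[of 2 4] n2 n8 f10 by simp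
    then have n7: "7 \<notin> H"
      using cons[of 6] f10 by auto
    then have m3: "3 \<in> H"
      using pairs[of 2 3] n2 n8 f10 by simp
    have H: "H = multiples_plus_ordinary 3 10"
      unfolding multiples_plus_ordinary_eq
      by (rule set_eqI, rule_tac x = x in less_11_cases)
        (use n1 n2 m3 n4 n5 m6 n7 n8 m9 n10 zero ab in simp_all)
    have "{l. l \<notin> H \<and> even l} = {2, 4, 8, 10}"
      unfolding H multiples_plus_ordinary_eq
      by (rule set_eqI, rule_tac x = x in less_11_cases) simp_all
    then have "hyperelliptic 4 H"
      using S by (rule_tac hyperellipticI) auto
    then show ?thesis using H by simp
  next
    case 5
    then have f12: "f \<ge> 12" by (simp add: f_def)
    \<comment> \<open>Now 5 is less than \<open>f / 2\<close>, so the pairs with index 3, 4 and 5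
      are all available; both positions of the exceptional pair are refuted.\<close>
    have False
    proof (cases "f - 1 \<in> H")
      case True
      then have e: "f - 2 \<notin> H"
        using edge 5 by auto
      have n4: "4 \<notin> H"
      proof
        assume "4 \<in> H"
        \<comment> \<open>Since \<open>f\<close> is even, 4 divides one of these two gaps.\<close>
        moreover have "4 dvd f \<or> 4 dvd f - 2"
          using evenf f12 by presburger
        ultimately show False
          using dvdH f e by blast
      qed
      then have m: "f - 4 \<in> H"
        using pairs[of 2 4] n2 e f12 by simp
      then have "f - 3 \<notin> H"
        using cons[of "f - 4"] f12 by (simp add: eval_nat_numeral Suc_diff_Suc)
      then have m3: "3 \<in> H"
        using pairs[of 2 3] n2 e f12 by simp
      have "f - 5 + 1 = f - 4"
        using f12 by simp
      then have "f - 5 \<notin> H"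
        using cons[of "f - 5"] m f12 by fastforce
      then have m5: "5 \<in> H"
        using pairs[of 2 5] n2 e f12 by simp
      \<comment> \<open>The three numbers represent all residues modulo 3, so
        \<open>3 \<in> H\<close> puts one of them into \<open>H\<close>; but 5 and 10 lie in
        \<open>H\<close>, which makes all three gaps.\<close>
      have "3 dvd f \<or> 3 dvd f - 5 \<or> 3 dvd f - 10"
        using f12 by presburger
      then have "f \<in> H \<or> f - 5 \<in> H \<or> f - 10 \<in> H"
        using dvdH m3 by blast
      then show False
        using f diff[of 5] m5 add[of 5 5] diff[of 10] f12 by auto
    next
      case False
      then have e: "f - 2 \<in> H"
        using edge 5 by auto
      have "f - 3 + 1 = f - 2"
        using f12 by simp
      then have "f - 3 \<notin> H"
        using cons[of "f - 3"] e f12 by fastforce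
      then have m3: "3 \<in> H"
        using pairs[of 1 3] n1 False f12 by simp
      then have "4 \<notin> H"
        using cons[of 3] f12 by auto
      then have "f - 4 \<in> H"
        using pairs[of 1 4] n1 False f12 by simp
      \<comment> \<open>The contradiction is that 3 and \<open>f - 4\<close> add up to the gap
        \<open>f - 1\<close>.\<close>
      then have "f - 4 + 3 \<in> H"
        using add m3 by blast
      moreover have "f - 4 + 3 = f - 1"
        using f12 by simp
      ultimately show False
        using False by simp
    qed
    then show ?thesis ..
  qed
qed

end
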